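(* Let $A\in\mathbb{R}^{m\times n}$ have nonnegative entries and let $y\in\mathbb{R}^m_{\ge0}$. Assume that every row and every column of $A$ contains at least one strictly positive entry, and that $A^\top y>0$ (componentwise). Let $C\subset\mathbb{R}^n$ be a convex set with $C\cap\mathbb{R}^n_{>0}\ne\emptyset$ such that $C_\theta:=\{\theta\in\mathbb{R}^n:e^\theta\in C\}$ is closed and convex. Let $g(\theta)=\mathrm{KL}(y,Ae^\theta)$ and $F(\theta)=g(\theta)+\iota_{C_\theta}(\theta)$ for $\theta\in\mathbb{R}^n$. Let $(x^{(r)})_{r\in\mathbb{N}}$ be the iterates of the constrained EMML algorithm (described in the context), started from $x^{(0)}\in\mathbb{R}^n_{>0}$, put $\theta^{(r)}=\log x^{(r)}$, and assume that the iterates $(x^{(r)})_{r\in\mathbb{N}}$ of the algorithm stay bounded. Then the algorithm converges in the following sense: (i) any limit point of $(\theta^{(r)})_{r\in\mathbb{N}}$ is a critical point of $F$; (ii) if $F$ satisfies the Kurdyka–Łojasiewicz property on $\operatorname{dom}F$, then $(\theta^{(r)})_{r\in\mathbb{N}}$ has finite length, i.e. $\sum_{r}\|\theta^{(r+1)}-\theta^{(r)}\|<\infty$, and converges to a critical point of $F$. Moreover: (iii) for any integer $N\ge1$ and any initial point $x^{(0)}\in\mathbb{R}^n_{>0}$, there exists a constant $K$ such that the iterates of the algorithm satisfy $$\min_{1\le k\le N}\|x^{(k)}-x^{(k+1)}\|^2\le\frac{K}{N}\bigl(g(\theta^{(0)})-\inf g\bigr).$$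
   Context: Exponentials, logarithms and divisions of vectors are componentwise, $\odot$ is the componentwise product, $\mathbf{1}$ is the all-ones vector. For $u\in\mathbb{R}^m_{\ge0}$, $v\in\mathbb{R}^m_{>0}$, $\mathrm{KL}(u,v)=\sum_{i=1}^m\bigl[u_i\log\frac{u_i}{v_i}+v_i-u_i\bigr]$ with $0\log0=0$. $\iota_{C_\theta}$ is the indicator function ($0$ on $C_\theta$, $+\infty$ elsewhere). $\inf g$ is the infimum of $g$ over $\mathbb{R}^n$. Constrained EMML algorithm. Set $w_j=\sum_iA_{ij}$. Given $x^{(r)}\in\mathbb{R}^n_{>0}$, compute $$\tilde x^{(r)}=x^{(r)}\odot\frac{A^\top(y/(Ax^{(r)}))}{A^\top\mathbf{1}},$$ set $\tilde w=w\odot\tilde x^{(r)}$ and $\phi(x)=-\sum_j\tilde w_j\log x_j$ on $\mathbb{R}^n_{>0}$ (so $\phi$ depends on $r$), and let $$x^{(r+1)}=\operatorname{Proj}_C^\phi(\tilde x^{(r)})=\operatorname*{arg\,min}_{x\in C\cap\mathbb{R}^n_{>0}}D_\phi(x,\tilde x^{(r)}),$$ where $D_\phi(x,z)=\phi(x)-\phi(z)-\langle\nabla\phi(z),x-z\rangle$ is the Bregman divergence of $\phi$. A critical point of $F$ is a point $\theta$ with $0\in\partial F(\theta)$, where $\partial F$ is the limiting subdifferential (here $\partial F=\nabla g+\partial\iota_{C_\theta}$, with $\partial\iota_{C_\theta}$ the normal cone of $C_\theta$). The Kurdyka–Łojasiewicz property is the standard one: $F$ has it at $\bar\theta$ if there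 are $\eta\in(0,\infty]$, a neighborhood $U$ of $\bar\theta$ and a continuous concave $\varphi:[0,\eta)\to[0,\infty)$ with $\varphi(0)=0$, $\varphi$ being $C^1$ with $\varphi'>0$ on $(0,\eta)$, such that $\varphi'(F(\theta)-F(\bar\theta))\operatorname{dist}(0,\partial F(\theta))\ge1$ for all $\theta\in U$ with $F(\bar\theta)<F(\theta)<F(\bar\theta)+\eta$.
   Formalization: Part (ii) additionally assumes that the sequence θ^(r) has a limit point (bounded x^(r) may approach the boundary, so θ^(r) may diverge); part (iii) additionally assumes x^(0) ∈ C or g(θ^(0)) > inf g; both parts are false as literally stated. *)

theory Defs
  imports "HOL-Analysis.Analysis"
begin

definition vexp :: "real ^ 'k \<Rightarrow> real ^ 'k" where
  "vexp v = (\<chi> i. exp (v $ i))"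

definition vln :: "real ^ 'k \<Rightarrow> real ^ 'k" where
  "vln v = (\<chi> i. ln (v $ i))"

definition vdiv :: "real ^ 'k \<Rightarrow> real ^ 'k \<Rightarrow> real ^ 'k" where
  "vdiv u v = (\<chi> i. u $ i / v $ i)"

definition pos_orthant :: "(real ^ 'k) set" where
  "pos_orthant = {x. \<forall>i. 0 < x $ i}"

text \<open>
  The convention \<open>0 * log 0 = 0\<close> is automatic, since the product with the factor 0
  vanishes whatever the value of \<^const>\<open>ln\<close> at 0 is.
\<close>

definition KL :: "real ^ 'm \<Rightarrow> real ^ 'm \<Rightarrow> real" where
  "KL u v = (\<Sum>i\<in>UNIV. u $ i * ln (u $ i / v $ i) + v $ i - u $ i)"

definition log_set :: "(real ^ 'n) set \<Rightarrow> (real ^ 'n) set" where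
  "log_set C = {\<theta>. vexp \<theta> \<in> C}"

definition ext_indicator :: "'a set \<Rightarrow> 'a \<Rightarrow> ereal" where
  "ext_indicator S \<theta> = (if \<theta> \<in> S then 0 else \<infinity>)"

definition objective :: "real ^ 'n ^ 'm \<Rightarrow> real ^ 'm \<Rightarrow> real ^ 'n \<Rightarrow> real" where
  "objective A y \<theta> = KL y (A *v vexp \<theta>)"

definition constrained_objective ::
  "real ^ 'n ^ 'm \<Rightarrow> real ^ 'm \<Rightarrow> (real ^ 'n) set \<Rightarrow> real ^ 'n \<Rightarrow> ereal" where
  "constrained_objective A y C \<theta> = ereal (objective A y \<theta>) + ext_indicator (log_set C) \<theta>"

definition eff_domain :: "('a \<Rightarrow> ereal) \<Rightarrow> 'a set" where
  "eff_domain f = {x. f x < \<infinity>}"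

text \<open>
  The term \<open>frechet_derivative \<phi> (at z) (x - z)\<close> is the pairing of the gradient of \<open>\<phi>\<close>
  at \<open>z\<close> with \<open>x - z\<close>. It is meaningful only where \<open>\<phi>\<close> is differentiable at \<open>z\<close>.
\<close>

definition bregman :: "('a::real_normed_vector \<Rightarrow> real) \<Rightarrow> 'a \<Rightarrow> 'a \<Rightarrow> real" where
  "bregman \<phi> x z = \<phi> x - \<phi> z - frechet_derivative \<phi> (at z) (x - z)"

definition emml_weights :: "real ^ 'n ^ 'm \<Rightarrow> real ^ 'n" where
  "emml_weights A = (\<chi> j. \<Sum>i\<in>UNIV. A $ i $ j)"

definition emml_step :: "real ^ 'n ^ 'm \<Rightarrow> real ^ 'm \<Rightarrow> real ^ 'n \<Rightarrow> real ^ 'n" where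
  "emml_step A y x = x * vdiv (transpose A *v vdiv y (A *v x)) (transpose A *v 1)"

text \<open>
  \<open>log_barrier v\<close> is meant on \<^const>\<open>pos_orthant\<close> only. That set is open, so the arbitrary
  values outside do not affect the derivative in \<^const>\<open>bregman\<close>.
\<close>

definition log_barrier :: "real ^ 'n \<Rightarrow> real ^ 'n \<Rightarrow> real" where
  "log_barrier v x = - (\<Sum>j\<in>UNIV. v $ j * ln (x $ j))"

text \<open>The sequence \<open>x\<close> is a run of the algorithm from the starting point \<open>x 0\<close>.\<close>

definition emml_iterates ::
  "real ^ 'n ^ 'm \<Rightarrow> real ^ 'm \<Rightarrow> (real ^ 'n) set \<Rightarrow> (nat \<Rightarrow> real ^ 'n) \<Rightarrow> bool" where
  "emml_iterates A y C x \<longleftrightarrow>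
     x 0 \<in> pos_orthant \<and>
     (\<forall>r. let xt = emml_step A y (x r); \<phi> = log_barrier (emml_weights A * xt)
          in is_arg_min (\<lambda>u. bregman \<phi> u xt) (\<lambda>u. u \<in> C \<inter> pos_orthant) (x (Suc r)))"

definition frechet_subdiff :: "('a::euclidean_space \<Rightarrow> ereal) \<Rightarrow> 'a \<Rightarrow> 'a set" where
  "frechet_subdiff f x =
     {v. \<bar>f x\<bar> \<noteq> \<infinity> \<and>
         0 \<le> Liminf (at x) (\<lambda>z. (f z - f x - ereal (v \<bullet> (z - x))) / ereal (norm (z - x)))}"

definition limiting_subdiff :: "('a::euclidean_space \<Rightarrow> ereal) \<Rightarrow> 'a \<Rightarrow> 'a set" where
  "limiting_subdiff f x =
     {v. \<bar>f x\<bar> \<noteq> \<infinity> \<and>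
         (\<exists>X V. X \<longlonglongrightarrow> x \<and> (\<lambda>k. f (X k)) \<longlonglongrightarrow> f x \<and>
                (\<forall>k. V k \<in> frechet_subdiff f (X k)) \<and> V \<longlonglongrightarrow> v)}"

definition critical_point :: "('a::euclidean_space \<Rightarrow> ereal) \<Rightarrow> 'a \<Rightarrow> bool" where
  "critical_point f x \<longleftrightarrow> 0 \<in> limiting_subdiff f x"

text \<open>
  Distance of the origin to a set, with value \<open>\<infinity>\<close> for the empty set
  (unlike \<^const>\<open>infdist\<close>, which is 0 there).
\<close>

definition dist0 :: "'a::real_normed_vector set \<Rightarrow> ereal" where
  "dist0 S = (INF v\<in>S. ereal (norm v))"

definition KL_property_at :: "('a::euclidean_space \<Rightarrow> ereal) \<Rightarrow> 'a \<Rightarrow> bool" where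
  "KL_property_at f xb \<longleftrightarrow>
     (\<exists>(\<eta>::ereal) U (\<phi>::real \<Rightarrow> real) \<phi>'.
        0 < \<eta> \<and> open U \<and> xb \<in> U \<and>
        continuous_on {t. 0 \<le> t \<and> ereal t < \<eta>} \<phi> \<and>
        concave_on {t. 0 \<le> t \<and> ereal t < \<eta>} \<phi> \<and>
        (\<forall>t. 0 \<le> t \<and> ereal t < \<eta> \<longrightarrow> 0 \<le> \<phi> t) \<and>
        \<phi> 0 = 0 \<and>
        (\<forall>t. 0 < t \<and> ereal t < \<eta> \<longrightarrow> (\<phi> has_real_derivative \<phi>' t) (at t) \<and> 0 < \<phi>' t) \<and>
        continuous_on {t. 0 < t \<and> ereal t < \<eta>} \<phi>' \<and>
        (\<forall>x\<in>U. f xb < f x \<and> f x < f xb + \<eta> \<longrightarrow>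
           1 \<le> ereal (\<phi>' (real_of_ereal (f x - f xb))) * dist0 (limiting_subdiff f x)))"

end

theory Submission imports Defs begin

text \<open>
  In the coordinates \<open>\<theta> = log x\<close>, Jensen's inequality gives a separable majorant of \<open>g\<close>, and the
  Bregman projection of the EMML step minimizes exactly this majorant over \<open>C_\<theta>\<close>. Its strict
  convexity yields a decrease of \<open>g\<close> by a multiple of \<open>\<parallel>x_r - x_{r+1}\<parallel>\<^sup>2\<close>, which telescopes to the rate.
  The linear coefficient \<open>S(\<theta>)\<close> of the majorant is a mixture of softmax functions and hence globally
  Lipschitz; the optimality condition of the step makes \<open>S(\<theta>_r) - S(\<theta>_{r+1})\<close> a subgradient of \<open>F\<close> at
  \<open>\<theta>_{r+1}\<close>. Near a limit point the logarithm is Lipschitz, so both bounds are available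
  in \<open>\<theta>\<close> and the Kurdyka-Lojasiewicz argument gives finite length.
\<close>

section \<open>Subgradients and the Kurdyka-Lojasiewicz argument\<close>

text \<open>Both sides agree to first order at \<open>v = u\<close>, and the second derivative of
  their difference in \<open>v\<close> is \<open>1 / v - 1 / M\<close>, which is nonnegative up to
  \<open>M\<close>. The right side is the KL summand of \<open>v\<close> relative to
  \<open>u\<close>; this gives the strong convexity behind the descent.\<close>

lemma quadratic_le_KL_summand:
  fixes u v M :: real
  assumes "0 < u" "u \<le> M" "0 < v" "v \<le> M"
  shows "(u - v)\<^sup>2 / (2 * M) \<le> u - v - v * (ln u - ln v)"
proof -
  define f where "f t = u - t - t * (ln u - ln t) - (u - t)\<^sup>2 / (2 * M)" for t
  define f' where "f' t = ln t - ln u + (u - t) / M" for t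
  have M: "0 < M" using assms by simp
  have df: "(f has_real_derivative f' t) (at t)" if "0 < t" for t
    unfolding f_def f'_def using that M
    by (auto intro!: derivative_eq_intros simp: field_simps power2_eq_square)
  have df': "(f' has_real_derivative (1 / t - 1 / M)) (at t)" if "0 < t" for t
    unfolding f'_def using that M
    by (auto intro!: derivative_eq_intros simp: field_simps)
  have f'u: "f' u = 0" and fu: "f u = 0" by (auto simp: f_def f'_def)
  have mono: "f' s \<le> f' t" if "0 < s" "s \<le> t" "t \<le> M" for s t
  proof (rule DERIV_nonneg_imp_nondecreasing[OF that(2)])
    fix r assume "s \<le> r" "r \<le> t"
    then show "\<exists>d. (f' has_real_derivative d) (at r) \<and> 0 \<le> d"
      using df'[of r] that by (intro exI[of _ "1 / r - 1 / M"]) (auto simp: field_simps)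
  qed
  have "f u \<le> f v"
  proof (cases "u \<le> v")
    case True
    show ?thesis
    proof (rule DERIV_nonneg_imp_nondecreasing[OF True])
      fix r assume "u \<le> r" "r \<le> v"
      then show "\<exists>d. (f has_real_derivative d) (at r) \<and> 0 \<le> d"
        using df[of r] mono[of u r] f'u assms by auto
    qed
  next
    case False
    then have "v \<le> u" by simp
    then show ?thesis
    proof (rule DERIV_nonpos_imp_nonincreasing)
      fix r assume "v \<le> r" "r \<le> u"
      then show "\<exists>d. (f has_real_derivative d) (at r) \<and> d \<le> 0"
        using df[of r] mono[of r u] f'u assms by auto
    qed
  qed
  then show ?thesis using fu by (simp add: f_def)
qed

text \<open>The difference quotient is bounded below by \<open>- b * norm (z - p)\<close>, which
  tends to 0. This yields subgradients of an extended-valued function without a sum rule or any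
  differentiation.\<close>

lemma frechet_subdiffI_quadratic:
  fixes f :: "'a::euclidean_space \<Rightarrow> ereal"
  assumes fin: "f p = ereal c"
    and lower: "\<And>z. ereal (c + v \<bullet> (z - p) - b * (norm (z - p))\<^sup>2) \<le> f z"
  shows "v \<in> frechet_subdiff f p"
proof -
  have lim: "((\<lambda>z. ereal (- b * norm (z - p))) \<longlongrightarrow> 0) (at p)"
  proof -
    have "((\<lambda>z. - b * norm (z - p)) \<longlongrightarrow> - b * norm (p - p)) (at p)"
      by (intro tendsto_intros)
    then show ?thesis by (simp add: zero_ereal_def)
  qed
  have "0 = Liminf (at p) (\<lambda>z. ereal (- b * norm (z - p)))"
    using lim_imp_Liminf[OF _ lim] by simp
  also have "\<dots> \<le> Liminf (at p) (\<lambda>z. (f z - f p - ereal (v \<bullet> (z - p))) / ereal (norm (z - p)))"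
  proof (rule Liminf_mono, unfold eventually_at_filter, rule always_eventually, safe)
    fix z assume "z \<noteq> p"
    then have n: "norm (z - p) > 0" by simp
    have eq: "- b * norm (z - p) * norm (z - p) = - (b * (norm (z - p))\<^sup>2)"
      by (simp add: power2_eq_square)
    have "ereal (- b * norm (z - p)) * ereal (norm (z - p)) \<le> f z - f p - ereal (v \<bullet> (z - p))"
      using lower[of z] fin by (cases "f z") (auto simp: eq algebra_simps power2_eq_square)
    then show "ereal (- b * norm (z - p)) \<le> (f z - f p - ereal (v \<bullet> (z - p))) / ereal (norm (z - p))"
      using n by (subst ereal_le_divide_pos) (auto simp: mult.commute)
  qed
  finally show ?thesis using fin by (simp add: frechet_subdiff_def)
qed

lemma frechet_subdiff_subset_limiting: "frechet_subdiff f p \<subseteq> limiting_subdiff f p"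
proof
  fix v assume v: "v \<in> frechet_subdiff f p"
  then have "\<bar>f p\<bar> \<noteq> \<infinity>" by (simp add: frechet_subdiff_def)
  with v show "v \<in> limiting_subdiff f p"
    unfolding limiting_subdiff_def
    by (intro CollectI conjI exI[of _ "\<lambda>_. p"] exI[of _ "\<lambda>_. v"]) auto
qed

text \<open>Tangent inequality at \<open>s\<close>. It is applied on the open interval without 0,
  where \<open>s\<close> is interior; a desingularizing function may have infinite slope at
  0.\<close>

lemma concave_diff_ge:
  fixes \<phi> :: "real \<Rightarrow> real"
  assumes "concave_on {t. 0 \<le> t \<and> ereal t < \<eta>} \<phi>"
    and "0 < s" "ereal s < \<eta>" "0 < t" "t \<le> s"
    and "(\<phi> has_real_derivative D) (at s)"
  shows "D * (s - t) \<le> \<phi> s - \<phi> t"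
proof -
  let ?A = "{t. 0 < t \<and> ereal t < \<eta>}"
  have "x \<in> ?A" if "u \<in> ?A" "v \<in> ?A" "u \<le> x" "x \<le> v" for u v x
    using that le_less_trans[of "ereal x" "ereal v" \<eta>] by simp
  then have "convex ?A"
    by (intro is_interval_convex) (unfold is_interval_1, blast)
  then have cv: "convex_on ?A (\<lambda>t. - \<phi> t)"
    by (intro convex_on_subset[OF assms(1)[unfolded concave_on_def]]) auto
  have "open ?A"
    by (intro open_Collect_conj open_Collect_less continuous_intros)
  moreover have "ereal t < \<eta>" using assms by (meson ereal_less_eq(3) le_less_trans)
  moreover have "((\<lambda>t. - \<phi> t) has_real_derivative - D) (at s within ?A)"
    by (rule DERIV_minus[OF has_field_derivative_at_within[OF assms(6)]])
  ultimately have "- D * (t - s) \<le> - \<phi> t - - \<phi> s"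
    using assms \<open>convex ?A\<close>
    by (intro convex_on_imp_above_tangent[OF cv]) (auto simp: convex_connected interior_open)
  then show ?thesis by (simp add: algebra_simps)
qed

section \<open>Finite length from a Kurdyka-Lojasiewicz inequality\<close>

lemma mult_le_imp_two_le_add:
  fixes d e q :: real
  assumes "e\<^sup>2 \<le> d * q" "0 \<le> d" "0 \<le> q"
  shows "2 * e \<le> d + q"
proof -
  have "(2 * e)\<^sup>2 \<le> (d + q)\<^sup>2"
    using assms sum_squares_ge_zero[of "d - q" 0] by (simp add: power2_eq_square algebra_simps)
  then show ?thesis by (rule power2_le_imp_le) (use assms in simp)
qed

text \<open>Abstract form of the argument, with \<open>G r\<close> in the role of the gap between
  the objective at step \<open>r\<close> and its limit. Descent and slope bound are available only
  in a ball around \<open>l\<close>, so the proof must also show that a tail of the sequence never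
  leaves it.\<close>

lemma KL_finite_length:
  fixes \<theta> :: "nat \<Rightarrow> 'a::real_normed_vector" and G :: "nat \<Rightarrow> real"
  assumes s: "strict_mono s" and lim: "(\<theta> \<circ> s) \<longlonglongrightarrow> l"
    and G: "\<And>r. 0 < G r" and antimono: "\<And>r. G (Suc r) \<le> G r" and G0: "G \<longlonglongrightarrow> 0"
    and pos: "0 < \<rho>" "0 < a" "0 < b" "0 < \<eta>"
    and descent: "\<And>r. norm (\<theta> r - l) < \<rho> \<Longrightarrow> a * (norm (\<theta> (Suc r) - \<theta> r))\<^sup>2 \<le> G r - G (Suc r)"
    and slope: "\<And>r. norm (\<theta> (Suc r) - l) < \<rho> \<Longrightarrow> ereal (G (Suc r)) < \<eta> \<Longrightarrow>
        1 \<le> \<phi>' (G (Suc r)) * (b * norm (\<theta> (Suc r) - \<theta> r))"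
    and cont: "continuous_on {t. 0 \<le> t \<and> ereal t < \<eta>} \<phi>"
    and conc: "concave_on {t. 0 \<le> t \<and> ereal t < \<eta>} \<phi>"
    and nonneg: "\<And>t. 0 \<le> t \<Longrightarrow> ereal t < \<eta> \<Longrightarrow> 0 \<le> \<phi> t" and zero: "\<phi> 0 = 0"
    and deriv: "\<And>t. 0 < t \<Longrightarrow> ereal t < \<eta> \<Longrightarrow> (\<phi> has_real_derivative \<phi>' t) (at t) \<and> 0 < \<phi>' t"
  shows "summable (\<lambda>r. norm (\<theta> (Suc r) - \<theta> r))"
proof -
  define d where "d r = norm (\<theta> (Suc r) - \<theta> r)" for r
  define c where "c = b / a"
  have c: "0 < c" using pos by (simp add: c_def)
  have d0: "0 \<le> d r" for r by (simp add: d_def)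
  have Glim: "(\<lambda>k. G (s k)) \<longlonglongrightarrow> 0"
    using LIMSEQ_subseq_LIMSEQ[OF G0 s] by (simp add: o_def)
  have ev: "\<forall>\<^sub>F k in sequentially. ereal (G (s k)) < \<eta>"
  proof -
    have "(\<lambda>k. ereal (G (s k))) \<longlonglongrightarrow> ereal 0" using Glim by simp
    then show ?thesis using pos(4) by (intro order_tendstoD(2)[where a=\<eta>]) (auto simp: zero_ereal_def)
  qed
  have "(\<lambda>k. \<phi> (G (s k))) \<longlonglongrightarrow> \<phi> 0"
  proof (rule continuous_on_tendsto_compose[OF cont Glim])
    show "0 \<in> {t. 0 \<le> t \<and> ereal t < \<eta>}" using pos by (simp add: zero_ereal_def)
    show "\<forall>\<^sub>F k in sequentially. G (s k) \<in> {t. 0 \<le> t \<and> ereal t < \<eta>}"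
      using ev by eventually_elim (auto simp: less_imp_le[OF G])
  qed
  moreover have "(\<lambda>k. norm (\<theta> (s k) - l)) \<longlonglongrightarrow> norm (l - l)"
    using lim unfolding o_def by (intro tendsto_intros)
  moreover have "(\<lambda>k. sqrt (G (s k) / a)) \<longlonglongrightarrow> sqrt (0 / a)"
    using Glim pos by (intro tendsto_intros) auto
  ultimately have "(\<lambda>k. norm (\<theta> (s k) - l) + 2 * sqrt (G (s k) / a) + c * \<phi> (G (s k))) \<longlonglongrightarrow>
      norm (l - l) + 2 * sqrt (0 / a) + c * \<phi> 0"
    by (intro tendsto_add tendsto_mult tendsto_const)
  \<comment> \<open>The left side bounds the distance to \<open>l\<close> of all later points: twice
    the first step is at most \<open>2 * sqrt (G R / a)\<close> by descent, and the remaining length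
    is at most \<open>c * \<phi> (G R)\<close>.\<close>
  then have "\<forall>\<^sub>F k in sequentially.
      norm (\<theta> (s k) - l) + 2 * sqrt (G (s k) / a) + c * \<phi> (G (s k)) < \<rho>"
    using pos zero by (intro order_tendstoD(2)) auto
  with ev obtain k where "ereal (G (s k)) < \<eta>"
      "norm (\<theta> (s k) - l) + 2 * sqrt (G (s k) / a) + c * \<phi> (G (s k)) < \<rho>"
    using eventually_happens'[OF sequentially_bot eventually_conj] by blast
  then obtain R where R: "ereal (G R) < \<eta>"
      "norm (\<theta> R - l) + 2 * sqrt (G R / a) + c * \<phi> (G R) < \<rho>" by blast
  have mono: "G r \<le> G R" if "R \<le> r" for r
    using that by (rule lift_Suc_antimono_le[of G, OF antimono])
  have dom: "ereal (G r) < \<eta>" if "R \<le> r" for r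
    using mono[OF that] R(1) by (meson ereal_less_eq(3) le_less_trans)
  have phi_ge: "0 \<le> \<phi> (G r)" if "R \<le> r" for r
    using nonneg[OF less_imp_le[OF G] dom[OF that]] .
  have R1: "norm (\<theta> R - l) < \<rho>"
  proof -
    have "0 \<le> sqrt (G R / a)" using G[of R] pos by simp
    moreover have "0 \<le> c * \<phi> (G R)" using phi_ge[of R] c by simp
    ultimately show ?thesis using R(2) by linarith
  qed
  have dR: "d R \<le> sqrt (G R / a)"
  proof (rule real_le_rsqrt)
    have "a * (d R)\<^sup>2 \<le> G R" using descent[OF R1] G[of "Suc R"] by (simp add: d_def)
    then show "(d R)\<^sup>2 \<le> G R / a" using pos by (simp add: field_simps)
  qed
  \<comment> \<open>Concavity converts the decrease of \<open>G\<close> into a decrease of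
    \<open>\<phi>\<close>, and the slope bound cancels the factor \<open>\<phi>'\<close>. This
    bounds the squared new step by the old step times \<open>c * ?\<Delta>\<close>, and the
    arithmetic-geometric mean inequality separates the product.\<close>
  have step: "2 * d (Suc r) \<le> d r + c * (\<phi> (G (Suc r)) - \<phi> (G (Suc (Suc r))))"
    if r: "R \<le> r" "norm (\<theta> (Suc r) - l) < \<rho>" for r
  proof -
    let ?D = "\<phi>' (G (Suc r))"
    have dm: "ereal (G (Suc r)) < \<eta>" using dom[of "Suc r"] r by simp
    note dv = deriv[OF G dm]
    have "?D * (a * (d (Suc r))\<^sup>2) \<le> ?D * (G (Suc r) - G (Suc (Suc r)))"
      using dv descent[OF r(2)] by (intro mult_left_mono) (auto simp: d_def)
    also have "\<dots> \<le> \<phi> (G (Suc r)) - \<phi> (G (Suc (Suc r)))" (is "_ \<le> ?\<Delta>")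
      using dv by (intro concave_diff_ge[OF conc G dm G antimono]) auto
    finally have 1: "?D * (a * (d (Suc r))\<^sup>2) \<le> ?\<Delta>" .
    have \<Delta>: "0 \<le> ?\<Delta>" using 1 dv pos by (meson less_imp_le mult_nonneg_nonneg order_trans zero_le_power2)
    have "a * (d (Suc r))\<^sup>2 \<le> (?D * (b * d r)) * (a * (d (Suc r))\<^sup>2)"
      using slope[OF r(2) dm] pos mult_right_mono[of 1 "?D * (b * d r)" "a * (d (Suc r))\<^sup>2"]
      by (simp add: d_def)
    also have "\<dots> = (b * d r) * (?D * (a * (d (Suc r))\<^sup>2))" by simp
    also have "\<dots> \<le> (b * d r) * ?\<Delta>"
      using 1 pos d0 by (intro mult_left_mono) auto
    finally have "(d (Suc r))\<^sup>2 \<le> d r * (c * ?\<Delta>)"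
      using pos by (simp add: c_def field_simps)
    then show ?thesis
      using d0 c \<Delta> by (intro mult_le_imp_two_le_add) auto
  qed
  \<comment> \<open>Confinement and the length bound need a joint induction: \<open>step\<close>
    applies only inside the ball, and the length bound keeps the next point inside. The extra
    \<open>d (R + k)\<close> on the left absorbs the old step on the right of
    \<open>step\<close>.\<close>
  have main: "(\<forall>r\<in>{R..R + k}. norm (\<theta> r - l) < \<rho>) \<and>
      (\<Sum>r<k. d (Suc (R + r))) + d (R + k) \<le> d R + c * (\<phi> (G (Suc R)) - \<phi> (G (Suc (R + k))))" for k
  proof (induction k)
    case 0
    then show ?case using R1 by simp
  next
    case (Suc k)
    have "\<theta> (Suc (R + k)) - \<theta> R = (\<Sum>r<Suc k. \<theta> (Suc (R + r)) - \<theta> (R + r))"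
      using sum_lessThan_telescope[of "\<lambda>r. \<theta> (R + r)" "Suc k"] by simp
    then have "norm (\<theta> (Suc (R + k)) - \<theta> R) \<le> (\<Sum>r<Suc k. d (R + r))"
      unfolding d_def by (simp only: norm_sum)
    also have "\<dots> = d R + (\<Sum>r<k. d (Suc (R + r)))" by (subst sum.lessThan_Suc_shift) simp
    also have "\<dots> \<le> 2 * d R + c * (\<phi> (G (Suc R)) - \<phi> (G (Suc (R + k))))"
      using Suc.IH d0[of "R + k"] by linarith
    also have "\<dots> \<le> 2 * sqrt (G R / a) + c * \<phi> (G R)"
    proof -
      have "\<phi> (G (Suc R)) - \<phi> (G (Suc (R + k))) \<le> \<phi> (G R)"
      proof -
        have "0 \<le> \<phi>' (G R) * (G R - G (Suc R))"
          using deriv[OF G R(1)] antimono[of R] by (intro mult_nonneg_nonneg) auto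
        also have "\<dots> \<le> \<phi> (G R) - \<phi> (G (Suc R))"
          using deriv[OF G R(1)] by (intro concave_diff_ge[OF conc G R(1) G antimono]) auto
        finally show ?thesis using phi_ge[of "Suc (R + k)"] by simp
      qed
      then have "c * (\<phi> (G (Suc R)) - \<phi> (G (Suc (R + k)))) \<le> c * \<phi> (G R)"
        using c by (intro mult_left_mono) auto
      then show ?thesis using dR by linarith
    qed
    finally have "norm (\<theta> (Suc (R + k)) - \<theta> R) \<le> 2 * sqrt (G R / a) + c * \<phi> (G R)" .
    then have near: "norm (\<theta> (Suc (R + k)) - l) < \<rho>"
      using R(2) norm_triangle_ineq[of "\<theta> (Suc (R + k)) - \<theta> R" "\<theta> R - l"] by simp
    have "(\<Sum>r<Suc k. d (Suc (R + r))) + d (R + Suc k) = (\<Sum>r<k. d (Suc (R + r))) + 2 * d (Suc (R + k))"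
      by simp
    also have "\<dots> \<le> (\<Sum>r<k. d (Suc (R + r))) + d (R + k) + c * (\<phi> (G (Suc (R + k))) - \<phi> (G (Suc (R + Suc k))))"
      using step[OF _ near] by simp
    also have "\<dots> \<le> d R + c * (\<phi> (G (Suc R)) - \<phi> (G (Suc (R + Suc k))))"
      using Suc.IH by (simp add: algebra_simps)
    finally show ?case using Suc.IH near by (auto simp: le_Suc_eq)
  qed
  have "(\<Sum>r<k. d (Suc (R + r))) \<le> d R + c * \<phi> (G (Suc R))" for k
  proof -
    have "0 \<le> c * \<phi> (G (Suc (R + k)))" using c phi_ge[of "Suc (R + k)"] by simp
    then show ?thesis using main[of k] d0[of "R + k"] by (simp add: algebra_simps)
  qed
  then have "summable (\<lambda>r. d (Suc (R + r)))"
    by (intro summableI_nonneg_bounded d0)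
  then have "summable (\<lambda>r. d (r + Suc R))" by (simp add: add.commute)
  then have "summable d" using summable_iff_shift[of d "Suc R"] by blast
  then show ?thesis by (simp add: d_def[abs_def])
qed

section \<open>The EMML majorant\<close>

lemma vexp_nth [simp]: "vexp v $ i = exp (v $ i)"
  by (simp add: vexp_def)

lemma vexp_pos [simp]: "vexp v \<in> pos_orthant"
  by (simp add: pos_orthant_def)

lemma vexp_vln: "u \<in> pos_orthant \<Longrightarrow> vexp (vln u) = u"
  by (simp add: vec_eq_iff vln_def pos_orthant_def)

lemma bregman_log_barrier:
  fixes v z u :: "real ^ 'n"
  assumes "z \<in> pos_orthant"
  shows "bregman (log_barrier v) u z
    = log_barrier v u - log_barrier v z + (\<Sum>j\<in>UNIV. v $ j / z $ j * (u $ j - z $ j))"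
proof -
  have "(log_barrier v has_derivative (\<lambda>d. - (\<Sum>j\<in>UNIV. v $ j * (d $ j / z $ j)))) (at z)"
    unfolding log_barrier_def using assms
    by (auto intro!: derivative_eq_intros bounded_linear_imp_has_derivative[OF bounded_linear_vec_nth]
        simp: pos_orthant_def divide_inverse mult_ac)
  then show ?thesis
    by (simp add: bregman_def frechet_derivative_at[symmetric])
qed

text \<open>The coefficient \<open>S(\<theta>)\<close> of the majorant. The quotient is the share of
  component \<open>j\<close> in the forward value \<open>i\<close>, a weighted softmax in
  \<open>\<theta>\<close>; it distributes \<open>y $ i\<close> over the components, as in an
  E-step.\<close>

definition emml_mass :: "real ^ 'n ^ 'm \<Rightarrow> real ^ 'm \<Rightarrow> real ^ 'n \<Rightarrow> real ^ 'n" where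
  "emml_mass A y \<theta> =
     (\<chi> j. \<Sum>i\<in>UNIV. y $ i * (A $ i $ j * exp (\<theta> $ j) / (A *v vexp \<theta>) $ i))"

text \<open>The gradient of \<open>g\<close>. It enters only as the slope in the quadratic lower
  bound \<open>objective_ge_quadratic\<close>.\<close>

definition emml_grad :: "real ^ 'n ^ 'm \<Rightarrow> real ^ 'm \<Rightarrow> real ^ 'n \<Rightarrow> real ^ 'n" where
  "emml_grad A y \<theta> = emml_weights A * vexp \<theta> - emml_mass A y \<theta>"

text \<open>The factor 2 comes from numerator and denominator of the softmax, and
  \<open>CARD('n)\<close> from passing to the l1 norm. The summand 1 makes strict positivity
  immediate from \<open>0 \<le> y $ i\<close>.\<close>

definition emml_lip :: "real ^ 'n ^ 'm \<Rightarrow> real ^ 'm \<Rightarrow> real" where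
  "emml_lip A y = 2 * real CARD('n) * (\<Sum>i\<in>UNIV. y $ i) + 1"

locale emml =
  fixes A :: "real ^ 'n ^ 'm" and y :: "real ^ 'm"
  assumes A_nonneg: "0 \<le> A $ i $ j" and y_nonneg: "0 \<le> y $ i"
    and row_pos: "\<exists>j. 0 < A $ i $ j" and column_pos: "\<exists>i. 0 < A $ i $ j"
    and backprojection_pos: "transpose A *v y \<in> pos_orthant"
begin

lemma weights_pos: "0 < emml_weights A $ j"
proof -
  obtain i where "0 < A $ i $ j" using column_pos by blast
  then show ?thesis unfolding emml_weights_def
    by (auto intro!: sum_pos2[of _ i] simp: A_nonneg)
qed

lemma forward_pos: "0 < (A *v vexp \<theta>) $ i"
proof -
  obtain j where "0 < A $ i $ j" using row_pos by blast
  then show ?thesis unfolding matrix_vector_mult_def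
    by (auto intro!: sum_pos2[of _ j] simp: A_nonneg)
qed

text \<open>The denominator of the multiplicative update is \<open>emml_weights A\<close>, so it
  cancels. Hence the coefficients of the barrier in the algorithm are exactly the mass vector of the
  majorant.\<close>

lemma weights_mult_step:
  "emml_weights A $ j * emml_step A y (vexp \<theta>) $ j = emml_mass A y \<theta> $ j"
proof -
  have "(transpose A *v 1) $ j = emml_weights A $ j"
    by (simp add: vector_matrix_mult_def emml_weights_def)
  then have "emml_weights A $ j * emml_step A y (vexp \<theta>) $ j
      = exp (\<theta> $ j) * (transpose A *v vdiv y (A *v vexp \<theta>)) $ j"
    using weights_pos[of j] by (simp add: emml_step_def vdiv_def)
  also have "\<dots> = emml_mass A y \<theta> $ j"
    by (simp add: vector_matrix_mult_def emml_mass_def vdiv_def sum_distrib_left mult_ac)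
  finally show ?thesis .
qed

lemma step_pos: "emml_step A y (vexp \<theta>) \<in> pos_orthant"
proof -
  have "0 < emml_mass A y \<theta> $ j" for j
  proof -
    have "0 < (\<Sum>i\<in>UNIV. A $ i $ j * y $ i)"
      using backprojection_pos by (simp add: pos_orthant_def vector_matrix_mult_def mult.commute)
    then obtain i where "0 < A $ i $ j * y $ i"
      by (meson not_le sum_nonpos)
    then have "0 < A $ i $ j" "0 < y $ i"
      using A_nonneg[of i j] y_nonneg[of i] by (auto simp: zero_less_mult_iff)
    then have "0 < y $ i * (A $ i $ j * exp (\<theta> $ j) / (A *v vexp \<theta>) $ i)"
      using forward_pos[of \<theta> i] by simp
    then show ?thesis unfolding emml_mass_def
      by (auto intro!: sum_pos2[of _ i] divide_nonneg_pos simp: A_nonneg y_nonneg forward_pos)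
  qed
  then have "0 < emml_step A y (vexp \<theta>) $ j" for j
    using weights_pos[of j] by (metis weights_mult_step zero_less_mult_pos)
  then show ?thesis by (simp add: pos_orthant_def)
qed

section \<open>The objective and its separable majorant\<close>

lemma objective_nonneg: "0 \<le> objective A y \<theta>"
  unfolding objective_def KL_def
proof (rule sum_nonneg)
  fix i :: 'm
  let ?v = "(A *v vexp \<theta>) $ i"
  show "0 \<le> y $ i * ln (y $ i / ?v) + ?v - y $ i"
  proof (cases "y $ i = 0")
    case True
    then show ?thesis using forward_pos[of \<theta> i] by simp
  next
    case False
    then have y: "0 < y $ i" using y_nonneg[of i] by simp
    have "ln (?v / y $ i) \<le> ?v / y $ i - 1"
      using y forward_pos[of \<theta> i] by (intro ln_le_minus_one) simp
    then have "y $ i * ln (?v / y $ i) \<le> y $ i * (?v / y $ i - 1)"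
      using y by (intro mult_left_mono) auto
    then show ?thesis using y forward_pos[of \<theta> i] by (simp add: ln_div algebra_simps)
  qed
qed

lemma bdd_below_objective: "bdd_below (range (objective A y))"
  using objective_nonneg by (intro bdd_belowI[of _ 0]) auto

text \<open>The terms \<open>y $ i * ln (y $ i)\<close> cancel, and swapping the double sum turns
  the total forward value into a weighted sum of exponentials. What remains takes logarithms of
  positive numbers only.\<close>

lemma objective_diff:
  "objective A y \<theta>' - objective A y \<theta> =
    (\<Sum>i\<in>UNIV. - y $ i * (ln ((A *v vexp \<theta>') $ i) - ln ((A *v vexp \<theta>) $ i)))
    + (\<Sum>j\<in>UNIV. emml_weights A $ j * (exp (\<theta>' $ j) - exp (\<theta> $ j)))"
proof -
  \<comment> \<open>For \<open>y $ i = 0\<close> both sides vanish whatever the value of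
    \<open>ln 0\<close>; otherwise the logarithm of the quotient splits.\<close>
  have 1: "y $ i * ln (y $ i / (A *v vexp \<theta>) $ i) = y $ i * (ln (y $ i) - ln ((A *v vexp \<theta>) $ i))"
    for \<theta> i
    using forward_pos[of \<theta> i] y_nonneg[of i] by (cases "y $ i = 0") (auto simp: ln_div)
  have 2: "(\<Sum>i\<in>UNIV. (A *v vexp \<theta>) $ i) = (\<Sum>j\<in>UNIV. emml_weights A $ j * exp (\<theta> $ j))" for \<theta>
    unfolding emml_weights_def
    by (simp add: matrix_vector_mult_def sum_distrib_right) (rule sum.swap)
  show ?thesis
    unfolding objective_def KL_def 1
    by (simp add: sum.distrib sum_subtractf 2 algebra_simps flip: sum_negf)
qed

text \<open>Jensen's inequality for the logarithm, with the exponential's tangent at the mean \<open>D i\<close>.\<close>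

lemma objective_le_surrogate:
  "objective A y \<theta>' \<le> objective A y \<theta>
    + (\<Sum>j\<in>UNIV. emml_weights A $ j * (exp (\<theta>' $ j) - exp (\<theta> $ j)))
    - emml_mass A y \<theta> \<bullet> (\<theta>' - \<theta>)"
proof -
  define p where "p i j = A $ i $ j * exp (\<theta> $ j) / (A *v vexp \<theta>) $ i" for i j
  define D where "D i = (\<Sum>j\<in>UNIV. p i j * (\<theta>' $ j - \<theta> $ j))" for i
  have p0: "0 \<le> p i j" for i j
    using forward_pos[of \<theta> i] by (simp add: p_def A_nonneg)
  have p1: "(\<Sum>j\<in>UNIV. p i j) = 1" for i
    using forward_pos[of \<theta> i]
    by (simp add: p_def matrix_vector_mult_def flip: sum_divide_distrib)
  have ln_ge: "D i \<le> ln ((A *v vexp \<theta>') $ i) - ln ((A *v vexp \<theta>) $ i)" for i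
  proof -
    \<comment> \<open>The weights \<open>p i j\<close> sum to 1 and the increments centred at
      \<open>D i\<close> have mean 0, so the tangent values average to
      \<open>exp (D i)\<close>.\<close>
    have "(\<Sum>j\<in>UNIV. p i j * (exp (D i) * (1 + (\<theta>' $ j - \<theta> $ j - D i))))
        = (\<Sum>j\<in>UNIV. exp (D i) * p i j + exp (D i) * (p i j * (\<theta>' $ j - \<theta> $ j)) - exp (D i) * D i * p i j)"
      by (simp add: algebra_simps)
    also have "\<dots> = exp (D i)"
      by (simp only: sum.distrib sum_subtractf sum_distrib_left[symmetric] p1 D_def[symmetric] mult_1_right add_diff_cancel_right')
    finally have "exp (D i) = (\<Sum>j\<in>UNIV. p i j * (exp (D i) * (1 + (\<theta>' $ j - \<theta> $ j - D i))))" ..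
    also have "\<dots> \<le> (\<Sum>j\<in>UNIV. p i j * exp (\<theta>' $ j - \<theta> $ j))"
    proof (intro sum_mono mult_left_mono p0)
      fix j
      have "exp (D i) * (1 + (\<theta>' $ j - \<theta> $ j - D i)) \<le> exp (D i) * exp (\<theta>' $ j - \<theta> $ j - D i)"
        by (intro mult_left_mono exp_ge_add_one_self) simp
      then show "exp (D i) * (1 + (\<theta>' $ j - \<theta> $ j - D i)) \<le> exp (\<theta>' $ j - \<theta> $ j)"
        by (simp flip: exp_add)
    qed
    also have "\<dots> = (A *v vexp \<theta>') $ i / (A *v vexp \<theta>) $ i"
      by (simp add: p_def exp_diff matrix_vector_mult_def[of A "vexp \<theta>'"] sum_divide_distrib)
    finally have "D i \<le> ln ((A *v vexp \<theta>') $ i / (A *v vexp \<theta>) $ i)"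
      using forward_pos[of \<theta> i] forward_pos[of \<theta>' i] by (subst ln_ge_iff) auto
    then show ?thesis
      using forward_pos[of \<theta> i] forward_pos[of \<theta>' i] by (simp add: ln_div)
  qed
  have "emml_mass A y \<theta> \<bullet> (\<theta>' - \<theta>) = (\<Sum>j\<in>UNIV. \<Sum>i\<in>UNIV. y $ i * (p i j * (\<theta>' $ j - \<theta> $ j)))"
    by (simp add: inner_vec_def emml_mass_def p_def sum_distrib_right mult.assoc)
  also have "\<dots> = (\<Sum>i\<in>UNIV. y $ i * D i)"
    unfolding D_def sum_distrib_left by (rule sum.swap)
  also have "\<dots> \<le> (\<Sum>i\<in>UNIV. y $ i * (ln ((A *v vexp \<theta>') $ i) - ln ((A *v vexp \<theta>) $ i)))"
    by (intro sum_mono mult_left_mono ln_ge y_nonneg)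
  finally show ?thesis
    using objective_diff[of \<theta>' \<theta>] by (simp add: sum_negf)
qed

section \<open>Lipschitz mass and the quadratic lower bound\<close>

text \<open>Moving by \<open>?\<delta>\<close> changes each exponential by a factor of at most
  \<open>exp ?\<delta>\<close>, hence each softmax quotient by at most
  \<open>exp (2 * ?\<delta>)\<close>. Using this factor in the inverse form, with
  \<open>1 - 2 * ?\<delta> \<le> exp (- (2 * ?\<delta>))\<close> and quotients at most 1, gives a
  linear bound valid for all distances.\<close>

lemma emml_mass_diff_le:
  "emml_mass A y \<theta> $ j - emml_mass A y \<theta>' $ j \<le> 2 * (\<Sum>i\<in>UNIV. y $ i) * norm (\<theta> - \<theta>')"
proof -
  let ?\<delta> = "norm (\<theta> - \<theta>')"
  let ?v = "\<lambda>\<theta> i. (A *v vexp \<theta>) $ i"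
  let ?p = "\<lambda>\<theta> i. A $ i $ j * exp (\<theta> $ j) / ?v \<theta> i"
  have comp: "exp (\<theta>' $ k) \<le> exp ?\<delta> * exp (\<theta> $ k)" "exp (\<theta> $ k) \<le> exp ?\<delta> * exp (\<theta>' $ k)" for k
    using component_le_norm_cart[of "\<theta> - \<theta>'" k] by (auto simp flip: exp_add)
  have "?p \<theta> i - ?p \<theta>' i \<le> 2 * ?\<delta>" for i
  proof -
    have "?v \<theta>' i \<le> exp ?\<delta> * ?v \<theta> i"
      unfolding matrix_vector_mult_def using comp(1) A_nonneg
      by (auto simp: sum_distrib_left mult.left_commute intro!: sum_mono mult_left_mono)
    then have "A $ i $ j * exp (\<theta> $ j) * ?v \<theta>' i
        \<le> (A $ i $ j * (exp ?\<delta> * exp (\<theta>' $ j))) * (exp ?\<delta> * ?v \<theta> i)"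
      using comp(2)[of j] A_nonneg forward_pos[of \<theta>' i] by (intro mult_mono) (auto intro: mult_left_mono)
    then have "?p \<theta> i \<le> exp (2 * ?\<delta>) * ?p \<theta>' i"
      using forward_pos[of \<theta> i] forward_pos[of \<theta>' i] by (simp add: field_simps exp_double power2_eq_square)
    then have "exp (- (2 * ?\<delta>)) * ?p \<theta> i \<le> exp (- (2 * ?\<delta>)) * (exp (2 * ?\<delta>) * ?p \<theta>' i)"
      by (intro mult_left_mono) auto
    then have le: "exp (- (2 * ?\<delta>)) * ?p \<theta> i \<le> ?p \<theta>' i"
      by (simp add: mult.assoc[symmetric] flip: exp_add)
    have p0: "0 \<le> ?p \<theta> i" using A_nonneg forward_pos[of \<theta> i] by simp
    have "A $ i $ j * exp (\<theta> $ j) \<le> ?v \<theta> i"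
      unfolding matrix_vector_mult_def using A_nonneg
      by (auto intro!: member_le_sum[of j UNIV "\<lambda>j. A $ i $ j * exp (\<theta> $ j)"])
    then have p1: "?p \<theta> i \<le> 1" using forward_pos[of \<theta> i] by simp
    have "(1 - 2 * ?\<delta>) * ?p \<theta> i \<le> exp (- (2 * ?\<delta>)) * ?p \<theta> i"
      using p0 exp_ge_add_one_self[of "- (2 * ?\<delta>)"] by (intro mult_right_mono) auto
    then have "?p \<theta> i - ?p \<theta>' i \<le> 2 * ?\<delta> * ?p \<theta> i" using le unfolding left_diff_distrib by linarith
    also have "\<dots> \<le> 2 * ?\<delta> * 1" using p1 by (intro mult_left_mono) auto
    finally show ?thesis by simp
  qed
  then have "(\<Sum>i\<in>UNIV. y $ i * (?p \<theta> i - ?p \<theta>' i)) \<le> (\<Sum>i\<in>UNIV. y $ i * (2 * ?\<delta>))"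
    by (intro sum_mono mult_left_mono y_nonneg)
  then show ?thesis
    by (simp add: emml_mass_def right_diff_distrib sum_subtractf sum_distrib_right sum_distrib_left mult_ac)
qed

lemma emml_lip_pos: "0 < emml_lip A y"
  by (simp add: emml_lip_def y_nonneg sum_nonneg add_nonneg_pos)

lemma emml_mass_lipschitz: "norm (emml_mass A y \<theta> - emml_mass A y \<theta>') \<le> emml_lip A y * norm (\<theta> - \<theta>')"
proof -
  have "norm (emml_mass A y \<theta> - emml_mass A y \<theta>')
      \<le> (\<Sum>j\<in>UNIV. \<bar>(emml_mass A y \<theta> - emml_mass A y \<theta>') $ j\<bar>)"
    by (rule norm_le_l1_cart)
  also have "\<dots> \<le> (\<Sum>j\<in>(UNIV::'n set). 2 * (\<Sum>i\<in>UNIV. y $ i) * norm (\<theta> - \<theta>'))"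
    using emml_mass_diff_le[of \<theta> _ \<theta>'] emml_mass_diff_le[of \<theta>' _ \<theta>]
    by (intro sum_mono) (simp add: abs_le_iff norm_minus_commute)
  also have "\<dots> \<le> emml_lip A y * norm (\<theta> - \<theta>')"
    by (simp add: emml_lip_def algebra_simps)
  finally show ?thesis .
qed

text \<open>Follows from the majorization with its two points exchanged, so no differentiation is needed.\<close>

lemma objective_ge_quadratic:
  "objective A y p + emml_grad A y p \<bullet> (z - p) - emml_lip A y * (norm (z - p))\<^sup>2 \<le> objective A y z"
proof -
  have "(\<Sum>j\<in>UNIV. emml_weights A $ j * (exp (p $ j) - exp (z $ j)))
      \<le> (\<Sum>j\<in>UNIV. emml_weights A $ j * (exp (p $ j) * (p $ j - z $ j)))"
  proof (intro sum_mono mult_left_mono)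
    fix j
    have "exp (p $ j) * (1 + (z $ j - p $ j)) \<le> exp (p $ j) * exp (z $ j - p $ j)"
      by (intro mult_left_mono exp_ge_add_one_self) simp
    then show "exp (p $ j) - exp (z $ j) \<le> exp (p $ j) * (p $ j - z $ j)"
      by (simp add: algebra_simps flip: exp_add)
  qed (simp add: weights_pos less_imp_le)
  also have "\<dots> = - ((emml_weights A * vexp p) \<bullet> (z - p))"
    by (simp add: inner_vec_def algebra_simps flip: sum_negf)
  finally have 1: "objective A y p \<le> objective A y z
      - (emml_weights A * vexp p) \<bullet> (z - p) + emml_mass A y z \<bullet> (z - p)"
    using objective_le_surrogate[of p z] by (simp add: inner_diff_right)
  \<comment> \<open>Exchanging the points leaves the mass at \<open>z\<close> in the linear term.
    The Lipschitz bound replaces it by the mass at \<open>p\<close> at a quadratic cost.\<close>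
  have "(emml_mass A y z - emml_mass A y p) \<bullet> (z - p)
      \<le> norm (emml_mass A y z - emml_mass A y p) * norm (z - p)"
    by (rule norm_cauchy_schwarz)
  also have "\<dots> \<le> emml_lip A y * norm (z - p) * norm (z - p)"
    by (intro mult_right_mono emml_mass_lipschitz) auto
  finally show ?thesis
    using 1 by (simp add: emml_grad_def inner_diff_left power2_eq_square)
qed

section \<open>The Bregman projection as minimization of the majorant\<close>

text \<open>Since mass divided by step equals the weights, the gradient part of the divergence is
  linear with coefficients \<open>emml_weights A\<close>. The second sum is free of
  \<open>z\<close>, and the first is the part of the majorant that depends on its new point.\<close>

lemma bregman_emml:
  "bregman (log_barrier (emml_weights A * emml_step A y (vexp \<theta>))) (vexp z) (emml_step A y (vexp \<theta>))
    = (\<Sum>j\<in>UNIV. emml_weights A $ j * exp (z $ j) - emml_mass A y \<theta> $ j * z $ j)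
      - (\<Sum>j\<in>UNIV. emml_mass A y \<theta> $ j * (1 - ln (emml_step A y (vexp \<theta>) $ j)))"
proof -
  have nz: "emml_step A y (vexp \<theta>) $ j \<noteq> 0" for j
    using step_pos[of \<theta>] by (simp add: pos_orthant_def less_imp_neq[symmetric])
  have ratio: "emml_mass A y \<theta> $ j / emml_step A y (vexp \<theta>) $ j = emml_weights A $ j" for j
    using nz[of j] by (simp flip: weights_mult_step)
  have "emml_weights A $ j * (exp (z $ j) - emml_step A y (vexp \<theta>) $ j)
      = emml_weights A $ j * exp (z $ j) - emml_mass A y \<theta> $ j" for j
    by (simp add: right_diff_distrib weights_mult_step)
  then have "bregman (log_barrier (emml_weights A * emml_step A y (vexp \<theta>))) (vexp z) (emml_step A y (vexp \<theta>))
    = - (\<Sum>j\<in>UNIV. emml_mass A y \<theta> $ j * z $ j)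
      + (\<Sum>j\<in>UNIV. emml_mass A y \<theta> $ j * ln (emml_step A y (vexp \<theta>) $ j))
      + (\<Sum>j\<in>UNIV. emml_weights A $ j * exp (z $ j) - emml_mass A y \<theta> $ j)"
    by (simp add: bregman_log_barrier[OF step_pos] log_barrier_def weights_mult_step ratio)
  then show ?thesis
    by (simp add: sum.distrib sum_subtractf algebra_simps)
qed

text \<open>First-order variational inequality for the minimizer \<open>p\<close>. Convexity of
  \<open>log_set C\<close> keeps the segment from \<open>p\<close> to \<open>z\<close> feasible, so
  a negative directional derivative of the majorant would produce a smaller feasible value.\<close>

lemma update_optimal:
  assumes min: "is_arg_min (\<lambda>u. bregman (log_barrier (emml_weights A * emml_step A y (vexp \<theta>))) u
      (emml_step A y (vexp \<theta>))) (\<lambda>u. u \<in> C \<inter> pos_orthant) (vexp p)"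
    and conv: "convex (log_set C)" and z: "z \<in> log_set C"
  shows "0 \<le> (emml_weights A * vexp p - emml_mass A y \<theta>) \<bullet> (z - p)"
proof (rule ccontr)
  define h where "h z = (\<Sum>j\<in>UNIV. emml_weights A $ j * exp (z $ j) - emml_mass A y \<theta> $ j * z $ j)" for z
  assume neg: "\<not> ?thesis"
  have p: "p \<in> log_set C" using min by (simp add: is_arg_min_def log_set_def)
  have le: "h p \<le> h q" if "q \<in> log_set C" for q
  proof -
    have "vexp q \<in> C \<inter> pos_orthant" using that by (simp add: log_set_def)
    then have "\<not> bregman (log_barrier (emml_weights A * emml_step A y (vexp \<theta>))) (vexp q) (emml_step A y (vexp \<theta>))
      < bregman (log_barrier (emml_weights A * emml_step A y (vexp \<theta>))) (vexp p) (emml_step A y (vexp \<theta>))"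
      using min unfolding is_arg_min_def by blast
    then show ?thesis by (simp add: bregman_emml h_def)
  qed
  have "((\<lambda>t. h (p + t *\<^sub>R (z - p))) has_real_derivative
      (emml_weights A * vexp p - emml_mass A y \<theta>) \<bullet> (z - p)) (at 0)"
    unfolding h_def by (auto intro!: derivative_eq_intros simp: inner_vec_def algebra_simps)
  from DERIV_neg_dec_right[OF this] neg obtain d where d: "d > 0"
    "\<And>t. 0 < t \<Longrightarrow> t < d \<Longrightarrow> h (p + t *\<^sub>R (z - p)) < h p" by auto
  define t where "t = min 1 (d / 2)"
  have t: "0 < t" "t < d" "t \<le> 1" using d(1) by (auto simp: t_def)
  have "(1 - t) *\<^sub>R p + t *\<^sub>R z \<in> log_set C"
    using conv p z t by (intro convexD_alt) auto
  then have "p + t *\<^sub>R (z - p) \<in> log_set C" by (simp add: algebra_simps)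
  then show False using le d(2)[OF t(1,2)] by force
qed

text \<open>The hypothesis \<open>opt\<close> is the variational inequality tested at the old point.
  It leaves a majorant gap of at least the weighted KL divergence of \<open>vexp p\<close> from
  \<open>vexp \<theta>\<close>, and \<open>quadratic_le_KL_summand\<close> bounds this below once
  \<open>M\<close> dominates both points.\<close>

lemma objective_descent:
  assumes opt: "0 \<le> (emml_weights A * vexp p - emml_mass A y \<theta>) \<bullet> (\<theta> - p)"
    and M: "\<And>j. exp (\<theta> $ j) \<le> M" "\<And>j. exp (p $ j) \<le> M"
  shows "Min (range (\<lambda>j. emml_weights A $ j)) / (2 * M) * (norm (vexp \<theta> - vexp p))\<^sup>2
    \<le> objective A y \<theta> - objective A y p"
proof -
  let ?w = "\<lambda>j. emml_weights A $ j"
  have M0: "0 < M" using M(1) exp_gt_zero less_le_trans by blast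
  have "(norm (vexp \<theta> - vexp p))\<^sup>2 = (\<Sum>j\<in>UNIV. (exp (\<theta> $ j) - exp (p $ j))\<^sup>2)"
    unfolding power2_norm_eq_inner by (simp add: inner_vec_def power2_eq_square)
  then have "Min (range ?w) / (2 * M) * (norm (vexp \<theta> - vexp p))\<^sup>2
      = (\<Sum>j\<in>UNIV. Min (range ?w) * ((exp (\<theta> $ j) - exp (p $ j))\<^sup>2 / (2 * M)))"
    by (simp add: sum_distrib_left)
  also have "\<dots> \<le> (\<Sum>j\<in>UNIV. ?w j * (exp (\<theta> $ j) - exp (p $ j) - exp (p $ j) * (\<theta> $ j - p $ j)))"
  proof (intro sum_mono mult_mono)
    fix j
    show "(exp (\<theta> $ j) - exp (p $ j))\<^sup>2 / (2 * M)
        \<le> exp (\<theta> $ j) - exp (p $ j) - exp (p $ j) * (\<theta> $ j - p $ j)"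
      using quadratic_le_KL_summand[of "exp (\<theta> $ j)" M "exp (p $ j)"] M by simp
  qed (use weights_pos M0 in \<open>auto simp: less_imp_le\<close>)
  also have "\<dots> = (\<Sum>j\<in>UNIV. ?w j * (exp (\<theta> $ j) - exp (p $ j))) - (emml_weights A * vexp p) \<bullet> (\<theta> - p)"
    by (simp add: inner_vec_def algebra_simps flip: sum_subtractf)
  also have "\<dots> \<le> (\<Sum>j\<in>UNIV. ?w j * (exp (\<theta> $ j) - exp (p $ j))) - emml_mass A y \<theta> \<bullet> (\<theta> - p)"
    using opt by (simp add: inner_diff_left)
  also have "\<dots> = - (\<Sum>j\<in>UNIV. ?w j * (exp (p $ j) - exp (\<theta> $ j))) + emml_mass A y \<theta> \<bullet> (p - \<theta>)"
    by (simp add: inner_diff_right right_diff_distrib sum_subtractf)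
  also have "\<dots> \<le> objective A y \<theta> - objective A y p"
    using objective_le_surrogate[of p \<theta>] by simp
  finally show ?thesis .
qed

text \<open>By \<open>opt\<close>, \<open>emml_mass A y \<theta> - emml_weights A * vexp p\<close>
  is normal to \<open>log_set C\<close> at \<open>p\<close>. Adding \<open>emml_grad A y p\<close>
  cancels the exponential term and leaves the difference of masses, which is small when
  \<open>\<theta>\<close> and \<open>p\<close> are close.\<close>

lemma mass_diff_in_subdiff:
  assumes p: "p \<in> log_set C"
    and opt: "\<And>z. z \<in> log_set C \<Longrightarrow> 0 \<le> (emml_weights A * vexp p - emml_mass A y \<theta>) \<bullet> (z - p)"
  shows "emml_mass A y \<theta> - emml_mass A y p \<in> frechet_subdiff (constrained_objective A y C) p"
proof (rule frechet_subdiffI_quadratic)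
  show "constrained_objective A y C p = ereal (objective A y p)"
    using p by (simp add: constrained_objective_def ext_indicator_def)
  fix z
  show "ereal (objective A y p + (emml_mass A y \<theta> - emml_mass A y p) \<bullet> (z - p)
      - emml_lip A y * (norm (z - p))\<^sup>2) \<le> constrained_objective A y C z"
  proof (cases "z \<in> log_set C")
    case True
    then show ?thesis
      using opt[OF True] objective_ge_quadratic[of p z]
      by (simp add: constrained_objective_def ext_indicator_def emml_grad_def inner_diff_left)
  qed (simp add: constrained_objective_def ext_indicator_def)
qed

lemma continuous_on_objective: "continuous_on UNIV (objective A y)"
proof -
  have fwd: "continuous_on UNIV (\<lambda>\<theta>. (A *v vexp \<theta>) $ i)" for i
    unfolding matrix_vector_mult_def by (simp, intro continuous_intros)
  \<comment> \<open>Writing the objective relative to the base point 0 avoids the logarithm of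
    \<open>y $ i / v\<close>, whose argument vanishes if \<open>y $ i = 0\<close>.\<close>
  have "continuous_on UNIV (\<lambda>\<theta>. objective A y 0 +
      ((\<Sum>i\<in>UNIV. - y $ i * (ln ((A *v vexp \<theta>) $ i) - ln ((A *v vexp 0) $ i)))
      + (\<Sum>j\<in>UNIV. emml_weights A $ j * (exp (\<theta> $ j) - exp (0 $ j)))))"
    by (intro continuous_intros fwd) (auto simp: less_imp_neq[OF forward_pos, symmetric])
  then show ?thesis by (simp only: objective_diff[symmetric]) simp
qed

end

section \<open>Runs of the algorithm\<close>

lemma abs_ln_diff_le:
  fixes u v c :: real
  assumes "0 < c" "c \<le> u" "c \<le> v"
  shows "\<bar>ln u - ln v\<bar> \<le> \<bar>u - v\<bar> / c"
proof -
  have *: "ln a - ln b \<le> \<bar>a - b\<bar> / c" if "c \<le> a" "c \<le> b" for a b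
  proof -
    have "ln a - ln b \<le> (a - b) / b"
      using that assms ln_diff_le[of a b] by simp
    also have "\<dots> \<le> \<bar>a - b\<bar> / b" using that assms by (intro divide_right_mono) auto
    also have "\<dots> \<le> \<bar>a - b\<bar> / c" using that assms by (intro divide_left_mono) auto
    finally show ?thesis .
  qed
  show ?thesis
    using *[of u v] *[of v u] assms by (simp add: abs_le_iff abs_minus_commute)
qed

lemma norm_vln_diff_le:
  fixes u v :: "real ^ 'n"
  assumes "0 < c" "\<And>j. c \<le> u $ j" "\<And>j. c \<le> v $ j"
  shows "norm (vln u - vln v) \<le> real CARD('n) / c * norm (u - v)"
proof -
  have "norm (vln u - vln v) \<le> (\<Sum>j\<in>UNIV. \<bar>(vln u - vln v) $ j\<bar>)"
    by (rule norm_le_l1_cart)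
  also have "\<dots> \<le> (\<Sum>j\<in>(UNIV::'n set). norm (u - v) / c)"
  proof (rule sum_mono)
    fix j
    have "\<bar>ln (u $ j) - ln (v $ j)\<bar> \<le> \<bar>u $ j - v $ j\<bar> / c"
      using assms by (intro abs_ln_diff_le)
    also have "\<dots> \<le> norm (u - v) / c"
      using component_le_norm_cart[of "u - v" j] assms by (intro divide_right_mono) auto
    finally show "\<bar>(vln u - vln v) $ j\<bar> \<le> norm (u - v) / c" by (simp add: vln_def)
  qed
  finally show ?thesis by simp
qed

locale emml_run = emml A y for A :: "real ^ 'n ^ 'm" and y +
  fixes C :: "(real ^ 'n) set" and x :: "nat \<Rightarrow> real ^ 'n"
  assumes closed_log_set: "closed (log_set C)" and convex_log_set: "convex (log_set C)"
    and iterates: "emml_iterates A y C x" and bounded_x: "bounded (range x)"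
begin

abbreviation "\<theta> r \<equiv> vln (x r)"
abbreviation "g \<equiv> objective A y"
abbreviation "F \<equiv> constrained_objective A y C"

section \<open>Descent along a run\<close>

lemma x_pos: "x r \<in> pos_orthant"
proof (cases r)
  case (Suc k)
  then show ?thesis
    using iterates unfolding emml_iterates_def by (auto simp: Let_def is_arg_min_def)
qed (use iterates in \<open>simp add: emml_iterates_def\<close>)

lemma vexp_\<theta> [simp]: "vexp (\<theta> r) = x r"
  by (rule vexp_vln[OF x_pos])

lemma exp_\<theta> [simp]: "exp (\<theta> r $ j) = x r $ j"
  by (metis vexp_\<theta> vexp_nth)

lemma \<theta>_Suc_mem: "\<theta> (Suc r) \<in> log_set C"
  using iterates unfolding emml_iterates_def
  by (auto simp: Let_def is_arg_min_def log_set_def)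

lemma \<theta>_optimal:
  "z \<in> log_set C \<Longrightarrow>
    0 \<le> (emml_weights A * vexp (\<theta> (Suc r)) - emml_mass A y (\<theta> r)) \<bullet> (z - \<theta> (Suc r))"
  using iterates unfolding emml_iterates_def
  by (intro update_optimal[OF _ convex_log_set]) (simp_all add: Let_def)

lemma subgradient_\<theta>:
  "emml_mass A y (\<theta> r) - emml_mass A y (\<theta> (Suc r)) \<in> frechet_subdiff F (\<theta> (Suc r))"
  using \<theta>_Suc_mem \<theta>_optimal by (rule mass_diff_in_subdiff)

text \<open>Boundedness of the run supplies one \<open>M\<close>, hence one constant
  \<open>D\<close>, for all steps. The premise holds for every \<open>r\<close> from 1 on; for
  \<open>r = 0\<close> it amounts to \<open>x 0\<close> lying in \<open>C\<close>.\<close>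

lemma descent_ex:
  obtains D where "0 < D"
    "\<And>r. \<theta> r \<in> log_set C \<Longrightarrow> D * (norm (x r - x (Suc r)))\<^sup>2 \<le> g (\<theta> r) - g (\<theta> (Suc r))"
proof -
  obtain M where M: "\<And>r. norm (x r) \<le> M" "0 < M"
    using bounded_x unfolding bounded_pos by auto
  have xM: "x r $ j \<le> M" for r j
    using component_le_norm_cart[of "x r" j] M(1)[of r] by simp
  let ?w = "Min (range (\<lambda>j. emml_weights A $ j))"
  have "0 < ?w" using weights_pos by (subst Min_gr_iff) auto
  show thesis
  proof (rule that[of "?w / (2 * M)"])
    show "0 < ?w / (2 * M)" using \<open>0 < ?w\<close> M by simp
    show "?w / (2 * M) * (norm (x r - x (Suc r)))\<^sup>2 \<le> g (\<theta> r) - g (\<theta> (Suc r))"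
      if "\<theta> r \<in> log_set C" for r
      using objective_descent[OF \<theta>_optimal[OF that], of M] xM by simp
  qed
qed

text \<open>Monotonicity starts at index 1, because the starting point may lie outside
  \<open>C\<close>.\<close>

lemma g_Suc_le: "g (\<theta> (Suc (Suc r))) \<le> g (\<theta> (Suc r))"
proof -
  obtain D where "0 < D"
    "\<And>r. \<theta> r \<in> log_set C \<Longrightarrow> D * (norm (x r - x (Suc r)))\<^sup>2 \<le> g (\<theta> r) - g (\<theta> (Suc r))"
    by (rule descent_ex) blast
  then show ?thesis using \<theta>_Suc_mem[of r]
    by (smt (verit) mult_nonneg_nonneg zero_le_power2)
qed

lemma g_convergent: "convergent (\<lambda>r. g (\<theta> (Suc r)))"
proof -
  have "decseq (\<lambda>r. g (\<theta> (Suc r)))"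
    using g_Suc_le by (rule decseq_SucI)
  then obtain L where "(\<lambda>r. g (\<theta> (Suc r))) \<longlonglongrightarrow> L"
    using decseq_convergent[of "\<lambda>r. g (\<theta> (Suc r))" 0] objective_nonneg by metis
  then show ?thesis by (auto simp: convergent_def)
qed

lemma x_diff_tendsto_0: "(\<lambda>r. norm (x r - x (Suc r))) \<longlonglongrightarrow> 0"
proof -
  obtain D where D: "0 < D"
    "\<And>r. \<theta> r \<in> log_set C \<Longrightarrow> D * (norm (x r - x (Suc r)))\<^sup>2 \<le> g (\<theta> r) - g (\<theta> (Suc r))"
    by (rule descent_ex) blast
  obtain L where L: "(\<lambda>r. g (\<theta> (Suc r))) \<longlonglongrightarrow> L"
    using g_convergent by (auto simp: convergent_def)
  have "(\<lambda>r. sqrt ((g (\<theta> (Suc r)) - g (\<theta> (Suc (Suc r)))) / D)) \<longlonglongrightarrow> sqrt ((L - L) / D)"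
    using D(1) by (intro tendsto_intros L LIMSEQ_Suc[OF L]) auto
  then have lim: "(\<lambda>r. sqrt ((g (\<theta> (Suc r)) - g (\<theta> (Suc (Suc r)))) / D)) \<longlonglongrightarrow> 0" by simp
  have "(\<lambda>r. norm (x (Suc r) - x (Suc (Suc r)))) \<longlonglongrightarrow> 0"
  proof (rule tendsto_sandwich[OF _ _ tendsto_const lim])
    show "\<forall>\<^sub>F r in sequentially. norm (x (Suc r) - x (Suc (Suc r)))
        \<le> sqrt ((g (\<theta> (Suc r)) - g (\<theta> (Suc (Suc r)))) / D)"
      using D(2)[OF \<theta>_Suc_mem] D(1)
      by (intro always_eventually allI real_le_rsqrt) (simp add: field_simps)
  qed simp
  then show ?thesis by (rule LIMSEQ_imp_Suc)
qed

section \<open>Limit points are critical\<close>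

lemma F_eq: "z \<in> log_set C \<Longrightarrow> F z = ereal (g z)"
  by (simp add: constrained_objective_def ext_indicator_def)

lemma tendsto_vln:
  assumes "(X \<longlongrightarrow> vexp l) f"
  shows "((\<lambda>k. vln (X k)) \<longlongrightarrow> l) f"
proof (rule vec_tendstoI)
  fix j
  have "((\<lambda>k. ln (X k $ j)) \<longlongrightarrow> ln (vexp l $ j)) f"
    by (intro tendsto_ln tendsto_vec_nth assms) simp
  then show "((\<lambda>k. vln (X k) $ j) \<longlongrightarrow> l $ j) f" by (simp add: vln_def)
qed

lemma continuous_on_vexp: "continuous_on UNIV (vexp :: real ^ 'n \<Rightarrow> real ^ 'n)"
  unfolding vexp_def by (intro continuous_intros)

lemma limit_point_mem:
  assumes s: "strict_mono s" and lim: "(\<lambda>k. \<theta> (s k)) \<longlonglongrightarrow> l"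
  shows "l \<in> log_set C"
proof (rule closed_sequentially[OF closed_log_set])
  \<comment> \<open>The first term is dropped because \<open>s 0\<close> may be 0, and the starting
    point may be infeasible.\<close>
  show "(\<lambda>k. \<theta> (s (Suc k))) \<longlonglongrightarrow> l" using lim by (rule LIMSEQ_Suc)
  fix k
  have "0 < s (Suc k)" using strict_monoD[OF s, of k "Suc k"] by simp
  then show "\<theta> (s (Suc k)) \<in> log_set C" using \<theta>_Suc_mem[of "s (Suc k) - 1"] by simp
qed

text \<open>The iterates of the subsequence and their predecessors have the same limit
  \<open>l\<close>, so the explicit subgradients, being differences of masses, tend to 0. Continuity
  of \<open>g\<close> gives the convergence of values that the limiting subdifferential
  demands.\<close>

lemma limit_point_critical:
  assumes s: "strict_mono s" and lim: "(\<lambda>k. \<theta> (s k)) \<longlonglongrightarrow> l"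
  shows "critical_point F l"
proof -
  \<comment> \<open>The predecessor indices; starting from \<open>s (Suc k)\<close>, which is
    positive, makes the subtraction exact.\<close>
  define q where "q k = s (Suc k) - 1" for k
  have sq: "s (Suc k) = Suc (q k)" for k
    using strict_monoD[OF s, of k "Suc k"] by (simp add: q_def)
  have q: "strict_mono q"
    unfolding strict_mono_Suc_iff using sq strict_monoD[OF s lessI] by (metis Suc_less_eq)
  have lim1: "(\<lambda>k. \<theta> (Suc (q k))) \<longlonglongrightarrow> l"
    using LIMSEQ_Suc[OF lim] by (simp add: sq)
  have "(\<lambda>k. vexp (\<theta> (Suc (q k)))) \<longlonglongrightarrow> vexp l"
    by (rule continuous_on_tendsto_compose[OF continuous_on_vexp lim1]) auto
  moreover have "(\<lambda>k. x (q k) - x (Suc (q k))) \<longlonglongrightarrow> 0"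
    using LIMSEQ_subseq_LIMSEQ[OF x_diff_tendsto_0 q] unfolding o_def by (rule tendsto_norm_zero_cancel)
  \<comment> \<open>Successive differences are known to vanish only for \<open>x\<close>, not for
    its logarithm. The predecessors are therefore handled in the \<open>x\<close> coordinates, where
    the limit \<open>vexp l\<close> is positive, and then mapped back by
    \<open>tendsto_vln\<close>.\<close>
  ultimately have "(\<lambda>k. (x (q k) - x (Suc (q k))) + x (Suc (q k))) \<longlonglongrightarrow> 0 + vexp l"
    by (intro tendsto_add) simp_all
  then have lim0: "(\<lambda>k. \<theta> (q k)) \<longlonglongrightarrow> l"
    by (intro tendsto_vln) simp
  have "(\<lambda>k. emml_mass A y (\<theta> (q k)) - emml_mass A y (\<theta> (Suc (q k)))) \<longlonglongrightarrow> 0"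
  proof (rule Lim_null_comparison)
    show "\<forall>\<^sub>F k in sequentially. norm (emml_mass A y (\<theta> (q k)) - emml_mass A y (\<theta> (Suc (q k))))
        \<le> emml_lip A y * norm (\<theta> (q k) - \<theta> (Suc (q k)))"
      by (intro always_eventually allI emml_mass_lipschitz)
    have "(\<lambda>k. emml_lip A y * norm (\<theta> (q k) - \<theta> (Suc (q k)))) \<longlonglongrightarrow> emml_lip A y * norm (l - l)"
      by (intro tendsto_intros lim0 lim1)
    then show "(\<lambda>k. emml_lip A y * norm (\<theta> (q k) - \<theta> (Suc (q k)))) \<longlonglongrightarrow> 0" by simp
  qed
  moreover have "(\<lambda>k. F (\<theta> (Suc (q k)))) \<longlonglongrightarrow> F l"
  proof -
    have "(\<lambda>k. g (\<theta> (Suc (q k)))) \<longlonglongrightarrow> g l"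
      by (rule continuous_on_tendsto_compose[OF continuous_on_objective lim1]) auto
    then show ?thesis by (simp add: F_eq \<theta>_Suc_mem limit_point_mem[OF s lim])
  qed
  ultimately show ?thesis
    unfolding critical_point_def limiting_subdiff_def
    using lim1 subgradient_\<theta> limit_point_mem[OF s lim]
    by (intro CollectI conjI exI[of _ "\<lambda>k. \<theta> (Suc (q k))"]
        exI[of _ "\<lambda>k. emml_mass A y (\<theta> (q k)) - emml_mass A y (\<theta> (Suc (q k)))"])
      (auto simp: F_eq)
qed

section \<open>Finite length and convergence of the whole sequence\<close>

lemma g_limit:
  assumes s: "strict_mono s" and lim: "(\<lambda>k. \<theta> (s k)) \<longlonglongrightarrow> l"
  shows "(\<lambda>r. g (\<theta> r)) \<longlonglongrightarrow> g l"
proof -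
  obtain L where L: "(\<lambda>r. g (\<theta> r)) \<longlonglongrightarrow> L"
    using g_convergent LIMSEQ_imp_Suc[of "\<lambda>r. g (\<theta> r)"] unfolding convergent_def by blast
  have "(\<lambda>k. g (\<theta> (s k))) \<longlonglongrightarrow> g l"
    by (rule continuous_on_tendsto_compose[OF continuous_on_objective lim]) auto
  then have "L = g l"
    using LIMSEQ_unique[OF LIMSEQ_subseq_LIMSEQ[OF L s, unfolded o_def]] by simp
  with L show ?thesis by simp
qed

lemma finite_length:
  assumes s: "strict_mono s" and lim: "(\<lambda>k. \<theta> (s k)) \<longlonglongrightarrow> l" and KL: "KL_property_at F l"
  shows "summable (\<lambda>r. norm (\<theta> (Suc r) - \<theta> r))"
proof -
  obtain D where D: "0 < D"
    "\<And>r. \<theta> r \<in> log_set C \<Longrightarrow> D * (norm (x r - x (Suc r)))\<^sup>2 \<le> g (\<theta> r) - g (\<theta> (Suc r))"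
    by (rule descent_ex) blast
  note l = limit_point_mem[OF s lim]
  note g_lim = LIMSEQ_Suc[OF g_limit[OF s lim]]
  have dec: "decseq (\<lambda>r. g (\<theta> (Suc r)))" using g_Suc_le by (rule decseq_SucI)
  have g_ge: "g l \<le> g (\<theta> (Suc r))" for r
    using decseq_ge[OF dec g_lim] .
  show ?thesis
  \<comment> \<open>The Kurdyka-Lojasiewicz inequality says nothing where \<open>F\<close> equals
    its limit value. If that value is attained after step 0, descent forces the run to be constant
    from then on.\<close>
  proof (cases "\<exists>r. g (\<theta> (Suc r)) = g l")
    case True
    then obtain R where R: "g (\<theta> (Suc R)) = g l" by blast
    have "\<theta> (Suc r) - \<theta> r = 0" if "Suc R \<le> r" for r
    proof -
      obtain k where k: "r = Suc k" "R \<le> k" using \<open>Suc R \<le> r\<close> by (cases r) auto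
      have "g (\<theta> (Suc k)) \<le> g l" using decseqD[OF dec k(2)] R by simp
      then have "D * (norm (x r - x (Suc r)))\<^sup>2 \<le> 0"
        using D(2)[OF \<theta>_Suc_mem[of k]] g_ge[of "Suc k"] k by simp
      then have "x r = x (Suc r)" using D(1) by (simp add: mult_le_0_iff)
      then show ?thesis by simp
    qed
    then show ?thesis
      by (intro summable_finite[of "{..R}"]) (auto simp: not_le Suc_le_eq)
  next
    case False
    then have g_gt: "g l < g (\<theta> (Suc r))" for r using g_ge[of r] by (metis order_le_less)
    obtain \<eta> :: ereal and U \<phi> \<phi>' where \<eta>: "0 < \<eta>" and U: "open U" "l \<in> U"
      and cont: "continuous_on {t. 0 \<le> t \<and> ereal t < \<eta>} \<phi>"
      and conc: "concave_on {t. 0 \<le> t \<and> ereal t < \<eta>} \<phi>"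
      and nonneg: "\<And>t. 0 \<le> t \<Longrightarrow> ereal t < \<eta> \<Longrightarrow> 0 \<le> \<phi> t" and zero: "\<phi> 0 = 0"
      and deriv: "\<And>t. 0 < t \<Longrightarrow> ereal t < \<eta> \<Longrightarrow> (\<phi> has_real_derivative \<phi>' t) (at t) \<and> 0 < \<phi>' t"
      and ineq: "\<And>z. z \<in> U \<Longrightarrow> F l < F z \<Longrightarrow> F z < F l + \<eta> \<Longrightarrow>
        1 \<le> ereal (\<phi>' (real_of_ereal (F z - F l))) * dist0 (limiting_subdiff F z)"
      using KL unfolding KL_property_at_def by blast
    obtain \<rho>' where \<rho>': "0 < \<rho>'" "ball l \<rho>' \<subseteq> U" using U openE by blast
    define \<rho> where "\<rho> = min 1 \<rho>'"
    have \<rho>: "0 < \<rho>" "\<rho> \<le> 1" "\<And>z. norm (z - l) < \<rho> \<Longrightarrow> z \<in> U"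
      using \<rho>' by (auto simp: \<rho>_def dist_norm norm_minus_commute subset_iff)
    \<comment> \<open>Within distance 1 of \<open>l\<close>, every entry of \<open>x r\<close> is at
      least \<open>2 * m\<close>. The factor 2 leaves room for the next iterate, which may leave the
      ball but moves by less than \<open>m\<close> from index \<open>r0\<close> on.\<close>
    define m where "m = exp (- norm l - 1) / 2"
    have m: "0 < m" by (simp add: m_def)
    have x_ge: "2 * m \<le> x r $ j" if "norm (\<theta> r - l) < \<rho>" for r j
    proof -
      have "\<bar>(\<theta> r - l) $ j\<bar> \<le> 1" "\<bar>l $ j\<bar> \<le> norm l"
        using component_le_norm_cart[of "\<theta> r - l" j] component_le_norm_cart[of l j] that \<rho>(2) by auto
      then have "- norm l - 1 \<le> \<theta> r $ j" unfolding vector_minus_component by linarith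
      then have "exp (- norm l - 1) \<le> exp (\<theta> r $ j)" by (simp only: exp_le_cancel_iff)
      then show ?thesis by (simp add: m_def)
    qed
    obtain r0 where r0: "\<And>r. r0 \<le> r \<Longrightarrow> norm (x r - x (Suc r)) < m"
      using order_tendstoD(2)[OF x_diff_tendsto_0 m] by (auto simp: eventually_sequentially)
    define \<kappa> where "\<kappa> = real CARD('n) / m"
    have \<kappa>: "0 < \<kappa>" using m by (simp add: \<kappa>_def)
    \<comment> \<open>The shift makes all indices at least \<open>r0\<close>, for small steps, and
      at least 1, for feasibility.\<close>
    define t where "t r = Suc (r0 + r)" for r
    have "summable (\<lambda>r. norm (\<theta> (t (Suc r)) - \<theta> (t r)))"
    \<comment> \<open>The subsequence is reindexed to match the shift; \<open>s n \<ge> n\<close>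
      makes the subtraction exact. The constant \<open>D / \<kappa>\<^sup>2\<close> converts descent
      in \<open>x\<close> into descent in \<open>\<theta>\<close>, as \<open>\<kappa>\<close> is a
      Lipschitz constant of the logarithm on entries at least \<open>m\<close>.\<close>
    proof (rule KL_finite_length[where \<theta> = "\<lambda>r. \<theta> (t r)" and G = "\<lambda>r. g (\<theta> (t r)) - g l"
          and s = "\<lambda>k. s (k + Suc r0) - Suc r0" and l = l and \<rho> = \<rho> and a = "D / \<kappa>\<^sup>2"
          and b = "emml_lip A y" and \<eta> = \<eta> and \<phi> = \<phi> and \<phi>' = \<phi>'])
      have ge: "Suc r0 \<le> s (k + Suc r0)" for k
        using strict_mono_imp_increasing[OF s, of "k + Suc r0"] by simp
      show "strict_mono (\<lambda>k. s (k + Suc r0) - Suc r0)"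
      proof (rule strict_monoI)
        fix i j :: nat assume "i < j"
        then show "s (i + Suc r0) - Suc r0 < s (j + Suc r0) - Suc r0"
          using strict_monoD[OF s, of "i + Suc r0" "j + Suc r0"] ge[of i] by simp
      qed
      have "t (s (k + Suc r0) - Suc r0) = s (k + Suc r0)" for k
        using ge[of k] by (simp add: t_def)
      then show "((\<lambda>r. \<theta> (t r)) \<circ> (\<lambda>k. s (k + Suc r0) - Suc r0)) \<longlonglongrightarrow> l"
        unfolding o_def using LIMSEQ_ignore_initial_segment[OF lim, of "Suc r0"] by simp
      show "0 < g (\<theta> (t r)) - g l" for r using g_gt by (simp add: t_def)
      show "g (\<theta> (t (Suc r))) - g l \<le> g (\<theta> (t r)) - g l" for r
        using g_Suc_le by (simp add: t_def)
      have "(\<lambda>r. g (\<theta> (t r)) - g l) \<longlonglongrightarrow> g l - g l"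
        using LIMSEQ_ignore_initial_segment[OF g_lim, of r0]
        by (intro tendsto_intros) (simp add: t_def add.commute)
      then show "(\<lambda>r. g (\<theta> (t r)) - g l) \<longlonglongrightarrow> 0" by simp
      show "0 < D / \<kappa>\<^sup>2" using D(1) \<kappa> by simp
      show "D / \<kappa>\<^sup>2 * (norm (\<theta> (t (Suc r)) - \<theta> (t r)))\<^sup>2 \<le> (g (\<theta> (t r)) - g l) - (g (\<theta> (t (Suc r))) - g l)"
        if near: "norm (\<theta> (t r) - l) < \<rho>" for r
      proof -
        have xm: "m \<le> x (t r) $ j" "m \<le> x (t (Suc r)) $ j" for j
          using x_ge[OF near, of j] r0[of "t r"] component_le_norm_cart[of "x (t r) - x (Suc (t r))" j] m
          by (auto simp: t_def)
        have "norm (\<theta> (t (Suc r)) - \<theta> (t r)) \<le> \<kappa> * norm (x (t r) - x (t (Suc r)))"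
          using norm_vln_diff_le[OF m xm(2) xm(1)] by (simp add: \<kappa>_def norm_minus_commute)
        then have "(norm (\<theta> (t (Suc r)) - \<theta> (t r)))\<^sup>2 \<le> \<kappa>\<^sup>2 * (norm (x (t r) - x (t (Suc r))))\<^sup>2"
          unfolding power_mult_distrib[symmetric] by (intro power_mono) auto
        then have "D / \<kappa>\<^sup>2 * (norm (\<theta> (t (Suc r)) - \<theta> (t r)))\<^sup>2
            \<le> D / \<kappa>\<^sup>2 * (\<kappa>\<^sup>2 * (norm (x (t r) - x (t (Suc r))))\<^sup>2)"
          using D(1) \<kappa> by (intro mult_left_mono) auto
        also have "\<dots> = D * (norm (x (t r) - x (t (Suc r))))\<^sup>2" using \<kappa> by simp
        also have "\<dots> \<le> g (\<theta> (t r)) - g (\<theta> (t (Suc r)))"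
          using D(2)[OF \<theta>_Suc_mem] by (simp add: t_def)
        finally show ?thesis by simp
      qed
      show "1 \<le> \<phi>' (g (\<theta> (t (Suc r))) - g l) * (emml_lip A y * norm (\<theta> (t (Suc r)) - \<theta> (t r)))"
        if near: "norm (\<theta> (t (Suc r)) - l) < \<rho>" and small: "ereal (g (\<theta> (t (Suc r))) - g l) < \<eta>" for r
      proof -
        let ?z = "\<theta> (t (Suc r))" and ?v = "emml_mass A y (\<theta> (t r)) - emml_mass A y (\<theta> (t (Suc r)))"
        have gt: "g l < g ?z" using g_gt by (simp add: t_def)
        have Fz: "F ?z = ereal (g ?z)" using \<theta>_Suc_mem by (simp add: F_eq t_def)
        have "F ?z < F l + \<eta>" using small by (cases \<eta>) (auto simp: Fz F_eq l)
        then have "1 \<le> ereal (\<phi>' (g ?z - g l)) * dist0 (limiting_subdiff F ?z)"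
          using ineq[OF \<rho>(3)[OF near]] gt by (simp add: Fz F_eq l)
        also have "\<dots> \<le> ereal (\<phi>' (g ?z - g l)) * ereal (emml_lip A y * norm (?z - \<theta> (t r)))"
        proof (rule ereal_mult_left_mono)
          have "?v \<in> limiting_subdiff F ?z"
            using subgradient_\<theta>[of "t r"] frechet_subdiff_subset_limiting by (auto simp: t_def)
          then have "dist0 (limiting_subdiff F ?z) \<le> ereal (norm ?v)"
            unfolding dist0_def by (rule INF_lower)
          also have "\<dots> \<le> ereal (emml_lip A y * norm (?z - \<theta> (t r)))"
            using emml_mass_lipschitz[of "\<theta> (t r)" ?z] by (simp add: norm_minus_commute)
          finally show "dist0 (limiting_subdiff F ?z) \<le> ereal (emml_lip A y * norm (?z - \<theta> (t r)))" .
          show "0 \<le> ereal (\<phi>' (g ?z - g l))"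
            using deriv[OF _ small] gt by simp
        qed
        finally show ?thesis by (simp add: one_ereal_def)
      qed
    qed (use \<rho>(1) emml_lip_pos \<eta> cont conc nonneg zero deriv in auto)
    then have "summable (\<lambda>r. norm (\<theta> (Suc (r + Suc r0)) - \<theta> (r + Suc r0)))"
      by (simp add: t_def add.commute)
    then show ?thesis
      using summable_iff_shift[of "\<lambda>r. norm (\<theta> (Suc r) - \<theta> r)" "Suc r0"] by blast
  qed
qed

lemma finite_length_imp_convergent:
  assumes s: "strict_mono s" and lim: "(\<lambda>k. \<theta> (s k)) \<longlonglongrightarrow> l"
    and sm: "summable (\<lambda>r. norm (\<theta> (Suc r) - \<theta> r))"
  shows "\<theta> \<longlonglongrightarrow> l"
proof -
  have "(\<lambda>n. \<Sum>r<n. \<theta> (Suc r) - \<theta> r) \<longlonglongrightarrow> (\<Sum>r. \<theta> (Suc r) - \<theta> r)"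
    using summable_norm_cancel[OF sm] by (rule summable_LIMSEQ)
  then have "(\<lambda>n. \<theta> 0 + (\<theta> n - \<theta> 0)) \<longlonglongrightarrow> \<theta> 0 + (\<Sum>r. \<theta> (Suc r) - \<theta> r)"
    unfolding sum_lessThan_telescope[of \<theta>] by (rule tendsto_add[OF tendsto_const])
  then have L: "\<theta> \<longlonglongrightarrow> \<theta> 0 + (\<Sum>r. \<theta> (Suc r) - \<theta> r)" (is "_ \<longlonglongrightarrow> ?L") by simp
  then have "?L = l"
    using LIMSEQ_unique[OF LIMSEQ_subseq_LIMSEQ[OF L s, unfolded o_def] lim] by simp
  with L show ?thesis by simp
qed

text \<open>Telescoping the descent from index 1 bounds the minimum by a multiple of
  \<open>g (\<theta> 1) - (INF t. g t)\<close>. The assumption serves to replace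
  \<open>\<theta> 1\<close> by \<open>\<theta> 0\<close>, since no descent is known for a step from
  an infeasible start. The resulting \<open>K\<close> is the same for all \<open>N\<close>.\<close>

lemma rate:
  assumes "x 0 \<in> C \<or> (INF t. g t) < g (\<theta> 0)"
  shows "\<exists>K. \<forall>N\<ge>1. Min ((\<lambda>k. (norm (x k - x (Suc k)))\<^sup>2) ` {1..N})
                     \<le> K / real N * (g (\<theta> 0) - (INF t. g t))"
proof -
  obtain D where D: "0 < D"
    "\<And>r. \<theta> r \<in> log_set C \<Longrightarrow> D * (norm (x r - x (Suc r)))\<^sup>2 \<le> g (\<theta> r) - g (\<theta> (Suc r))"
    by (rule descent_ex) blast
  let ?e = "\<lambda>k. (norm (x k - x (Suc k)))\<^sup>2"
  have inf_le: "(INF t. g t) \<le> g z" for z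
    by (rule cINF_lower[OF bdd_below_objective]) simp
  have le1: "Min (?e ` {1..N}) \<le> (g (\<theta> 1) - (INF t. g t)) / D / real N" if "1 \<le> N" for N
  proof -
    have "real N * Min (?e ` {1..N}) = (\<Sum>k=1..N. Min (?e ` {1..N}))" by simp
    also have "\<dots> \<le> (\<Sum>k=1..N. ?e k)" by (intro sum_mono Min_le) auto
    finally have "D * (real N * Min (?e ` {1..N})) \<le> D * (\<Sum>k=1..N. ?e k)"
      using D(1) by (intro mult_left_mono) auto
    also have "\<dots> \<le> (\<Sum>k=1..N. g (\<theta> k) - g (\<theta> (Suc k)))"
      unfolding sum_distrib_left
    proof (rule sum_mono)
      fix k assume "k \<in> {1..N}"
      then show "D * ?e k \<le> g (\<theta> k) - g (\<theta> (Suc k))"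
        using D(2)[of k] \<theta>_Suc_mem[of "k - 1"] by simp
    qed
    also have "\<dots> = g (\<theta> 1) - g (\<theta> (Suc N))"
      using sum_Suc_diff[of 1 N "\<lambda>k. - g (\<theta> k)"] that by simp
    also have "\<dots> \<le> g (\<theta> 1) - (INF t. g t)" using inf_le by simp
    finally show ?thesis using D(1) that by (simp add: field_simps)
  qed
  show ?thesis
  \<comment> \<open>With a positive initial gap, \<open>K\<close> rescales the bound by the ratio of
    the two gaps. With a zero gap the start is feasible, so the first step descends as well, both
    gaps vanish, and any \<open>K\<close> works.\<close>
  proof (cases "(INF t. g t) < g (\<theta> 0)")
    case True
    then show ?thesis
      using le1 by (intro exI[of _ "(g (\<theta> 1) - (INF t. g t)) / D / (g (\<theta> 0) - (INF t. g t))"]) simp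
  next
    case False
    with assms have "\<theta> 0 \<in> log_set C" by (simp add: log_set_def)
    then have "0 \<le> g (\<theta> 0) - g (\<theta> 1)"
      using D(2)[of 0] D(1) by (smt (verit) One_nat_def mult_nonneg_nonneg zero_le_power2)
    then have "g (\<theta> 1) = (INF t. g t)" "g (\<theta> 0) = (INF t. g t)"
      using False inf_le[of "\<theta> 1"] inf_le[of "\<theta> 0"] by linarith+
    then show ?thesis using le1 by auto
  qed
qed

end

text \<open>Boundedness of \<open>x\<close> bounds \<open>\<theta>\<close> only from above, since
  entries of \<open>x\<close> may approach 0; the existence of a limit point is therefore an
  explicit hypothesis of the second claim.\<close>

theorem proposition11:
  fixes A :: "real ^ 'n ^ 'm" and y :: "real ^ 'm" and C :: "(real ^ 'n) set"
    and x \<theta> :: "nat \<Rightarrow> real ^ 'n" and F :: "real ^ 'n \<Rightarrow> ereal" and g :: "real ^ 'n \<Rightarrow> real"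
  assumes "\<forall>i j. 0 \<le> A $ i $ j" and "\<forall>i. 0 \<le> y $ i"
    and "\<forall>i. \<exists>j. 0 < A $ i $ j" and "\<forall>j. \<exists>i. 0 < A $ i $ j"
    and "transpose A *v y \<in> pos_orthant"
    and "convex C" and "C \<inter> pos_orthant \<noteq> {}"
    and "closed (log_set C)" and "convex (log_set C)"
    and "g = objective A y" and "F = constrained_objective A y C"
    and "emml_iterates A y C x" and "\<theta> = (\<lambda>r. vln (x r))"
    and "bounded (range x)"
  shows "(\<forall>l s. strict_mono s \<and> (\<theta> \<circ> s) \<longlonglongrightarrow> l \<longrightarrow> critical_point F l) \<and>
    ((\<forall>\<theta>b\<in>eff_domain F. KL_property_at F \<theta>b) \<and>
       (\<exists>l s. strict_mono s \<and> (\<theta> \<circ> s) \<longlonglongrightarrow> l) \<longrightarrow>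
       summable (\<lambda>r. norm (\<theta> (Suc r) - \<theta> r)) \<and>
       (\<exists>l. \<theta> \<longlonglongrightarrow> l \<and> critical_point F l)) \<and>
    (x 0 \<in> C \<or> (INF t. g t) < g (\<theta> 0) \<longrightarrow>
       (\<exists>K. \<forall>N\<ge>1. Min ((\<lambda>k. (norm (x k - x (Suc k)))\<^sup>2) ` {1..N})
                     \<le> K / real N * (g (\<theta> 0) - (INF t. g t))))"
proof -
  interpret emml_run A y C x
    using assms(1-5,8,9,12,14) by unfold_locales blast+
  have crit: "critical_point F l" if "strict_mono s" "(\<theta> \<circ> s) \<longlonglongrightarrow> l" for l s
    using limit_point_critical[OF that(1), of l] that(2) unfolding assms(11,13) o_def .
  have kl: "summable (\<lambda>r. norm (\<theta> (Suc r) - \<theta> r)) \<and> (\<exists>l. \<theta> \<longlonglongrightarrow> l \<and> critical_point F l)"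
    if KL: "\<forall>\<theta>b\<in>eff_domain F. KL_property_at F \<theta>b" and s: "strict_mono s" "(\<theta> \<circ> s) \<longlonglongrightarrow> l" for l s
  proof -
    have lim: "(\<lambda>k. vln (x (s k))) \<longlonglongrightarrow> l" using s(2) unfolding assms(13) o_def .
    have "l \<in> eff_domain F"
      unfolding assms(11) eff_domain_def using F_eq[OF limit_point_mem[OF s(1) lim]] by simp
    with KL have "KL_property_at F l" by blast
    then have sm: "summable (\<lambda>r. norm (vln (x (Suc r)) - vln (x r)))"
      unfolding assms(11) by (rule finite_length[OF s(1) lim])
    then have "\<theta> \<longlonglongrightarrow> l"
      unfolding assms(13) by (rule finite_length_imp_convergent[OF s(1) lim])
    with crit[OF s] sm show ?thesis unfolding assms(13) by blast
  qed
  have rate: "\<exists>K. \<forall>N\<ge>1. Min ((\<lambda>k. (norm (x k - x (Suc k)))\<^sup>2) ` {1..N})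
      \<le> K / real N * (g (\<theta> 0) - (INF t. g t))" if "x 0 \<in> C \<or> (INF t. g t) < g (\<theta> 0)"
    using rate that unfolding assms(10,13) by blast
  show ?thesis
    by (intro conjI allI impI rate) (use crit kl in \<open>auto 0 3\<close>)
qed

end
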